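(* Let $(E,d)$ be a Polish space, $\mathcal{F}$ a stable class of closed subsets of $E$ equipped with a metric $d_{\mathcal{F}}$, $\tau:\mathcal{F}\to[0,\infty]$ a size function, and $(\mu_n)_{n\geq1}$ a $\tau$-tight sequence of random probability measures on $(E,\mathcal{B}(E))$ almost surely weakly converging to some $\mathcal{F}$-regular measure $\mu$. Let $0<\alpha<1$. Suppose that: (a) the mapping $\beta\mapsto\tau^\beta$ (defined with the measure $\mu$) is real-valued near $\alpha$ and continuous at $\alpha$; (b) for every sequence $(A_n)_{n\geq1}\subset\mathcal{F}$ such that $\tau(\lim_n A_n)<\infty$: if $\lim_n\tau(A_n)=\tau(\lim_n A_n)$, then $d_{\mathcal{F}}(A_n,\lim_k A_k)\to0$. Then, almost surely, $\mathrm{Haus}(\mathcal{S}_n^\alpha|\mathcal{S}^\alpha)\to0$ as $n\to\infty$, where $\mathcal{S}_n^\alpha=\arg\min\{\tau(A):A\in\mathcal{F},\ \mu_n(A)\geq1-\alpha\}$, $\mathcal{S}^\alpha=\arg\min\{\tau(A):A\in\mathcal{F},\ \mu(A)\geq1-\alpha\}$, and the Hausdorff contrast between these subsets of $\mathcal{F}$ is taken with respect to $d_{\mathcal{F}}$.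
   Context: For $B$ a subset of a metric space and $\varepsilon>0$, $B^\varepsilon$ is the set of points at distance $<\varepsilon$ from some point of $B$. For a sequence $(B_n)_{n\geq1}$ of closed subsets of $E$, $\lim_n B_n:=\bigcap_{\varepsilon>0}\bigcup_{k\geq1}\bigcap_{n\geq k}B_n^\varepsilon$. A class $\mathcal{F}$ of closed subsets of $E$ is stable if $E\in\mathcal{F}$ and every sequence $(B_n)_{n\geq1}\subset\mathcal{F}$ admits indices $(n_k)_{k\geq1}$, $n_k\to\infty$, with $\lim_k B_{n_k}\in\mathcal{F}$. Hausdorff contrast between two subsets $A,B$ of a metric space: $\mathrm{Haus}(A|B):=\inf\{\varepsilon>0: A\subset B^\varepsilon\}$. Size function: a map $\tau:\mathcal{F}\to[0,\infty]$ such that (i) $A\subset B\Rightarrow\tau(A)\leq\tau(B)$; (ii) for every decreasing sequence $(A_n)_{n\geq1}\subset\mathcal{F}$ with $\tau(A_1)<\infty$ and $\mathrm{Haus}(A_n|\bigcap_k A_k)\to0$, one has $\tau(A_n)\to\tau(\bigcap_n A_n)$; (iii) for every sequence $(A_n)_{n\geq1}\subset\mathcal{F}$, $\tau(\lim_n A_n)\leq\liminf_n\tau(A_n)$. By convention, statements involving $\tau$ (or $d_{\mathcal{F}}$) of a limit set or of an intersection refer to the situation where that set belongs to $\mathcal{F}$. For $0<\beta<1$, $\tau^\beta:=\inf\{\tau(A):A\in\mathcal{F},\ \mu(A)\geq1-\beta\}$. $\mu$ is $\mathcal{F}$-regular if for all $B\in\mathcal{F}$, any $\delta>0$ and any $C\in\mathcal{F}$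 with $B\subset C$ and $\mu(B)<\mu(B^\delta\cap C)$, there exists $A\in\mathcal{F}$ with $A\subset B^\delta\cap C$ and $\mu(B)<\mu(A)$. A sequence of random probability measures $(\mu_n)_{n\geq1}$ almost surely weakly converging to a measure $\mu$ is $\tau$-tight if for any $\delta>0$ and any $B\in\mathcal{F}$ with $\tau(B)<\infty$, almost surely, for any $C\in\mathcal{F}$ with $B\subset C$ and $\mu(B)\leq\liminf_n\mu_n(C)$, there exists $A\in\mathcal{F}$ such that $\mu(B)\leq\liminf_n\mu_n(A)$, $B\subset A\subset B^\delta\cap C$ and $\tau(A)<\infty$. *)

theory Defs
  imports "HOL-Probability.Probability"
begin

text \<open>
  The metric neighbourhood \<open>B\<^sup>\<epsilon>\<close> and the Hausdorff contrast are needed both in the ambient space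
  and in a class of closed sets carrying a metric of its own, hence the explicit carrier and
  distance, as in the locale \<^locale>\<open>Metric_space\<close>. The contrast is extended-valued, with
  \<open>inf \<emptyset> = \<infinity>\<close>.
\<close>

definition thickening :: "'b set \<Rightarrow> ('b \<Rightarrow> 'b \<Rightarrow> real) \<Rightarrow> 'b set \<Rightarrow> real \<Rightarrow> 'b set" where
  "thickening M d B \<epsilon> = (\<Union>y\<in>B. Metric_space.mball M d y \<epsilon>)"

definition haus :: "'b set \<Rightarrow> ('b \<Rightarrow> 'b \<Rightarrow> real) \<Rightarrow> 'b set \<Rightarrow> 'b set \<Rightarrow> ennreal" where
  "haus M d A B = Inf {ennreal \<epsilon> | \<epsilon>. \<epsilon> > 0 \<and> A \<subseteq> thickening M d B \<epsilon>}"

abbreviation nbhd :: "'a::metric_space set \<Rightarrow> real \<Rightarrow> 'a set" where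
  "nbhd B \<epsilon> \<equiv> thickening UNIV dist B \<epsilon>"

definition set_lim :: "(nat \<Rightarrow> 'a::metric_space set) \<Rightarrow> 'a set" where
  "set_lim B = (\<Inter>\<epsilon>\<in>{0<..}. \<Union>k. \<Inter>n\<in>{k..}. nbhd (B n) \<epsilon>)"

definition stable_class :: "'a::metric_space set set \<Rightarrow> bool" where
  "stable_class \<F> \<longleftrightarrow>
     (\<forall>A\<in>\<F>. closed A) \<and> UNIV \<in> \<F> \<and>
     (\<forall>B. range B \<subseteq> \<F> \<longrightarrow>
        (\<exists>r :: nat \<Rightarrow> nat. filterlim r at_top sequentially \<and> set_lim (\<lambda>k. B (r k)) \<in> \<F>))"

text \<open>
  Only the values of \<open>\<tau>\<close> on \<open>\<F>\<close> are relevant; conditions on the value of \<open>\<tau>\<close> at an intersection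
  or at a limit are imposed when that set belongs to \<open>\<F>\<close>.
\<close>

definition size_function :: "'a::metric_space set set \<Rightarrow> ('a set \<Rightarrow> ennreal) \<Rightarrow> bool" where
  "size_function \<F> \<tau> \<longleftrightarrow>
     (\<forall>A\<in>\<F>. \<forall>B\<in>\<F>. A \<subseteq> B \<longrightarrow> \<tau> A \<le> \<tau> B) \<and>
     (\<forall>A. range A \<subseteq> \<F> \<and> decseq A \<and> (\<Inter>k. A k) \<in> \<F> \<and> \<tau> (A 0) < \<infinity> \<and>
          (\<lambda>n. haus UNIV dist (A n) (\<Inter>k. A k)) \<longlonglongrightarrow> 0 \<longrightarrow>
        (\<lambda>n. \<tau> (A n)) \<longlonglongrightarrow> \<tau> (\<Inter>k. A k)) \<and>
     (\<forall>A. range A \<subseteq> \<F> \<and> set_lim A \<in> \<F> \<longrightarrow> \<tau> (set_lim A) \<le> liminf (\<lambda>n. \<tau> (A n)))"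

definition min_size ::
    "'a::topological_space set set \<Rightarrow> ('a set \<Rightarrow> ennreal) \<Rightarrow> 'a measure \<Rightarrow> real \<Rightarrow> ennreal" where
  "min_size \<F> \<tau> \<mu> \<beta> = Inf {\<tau> A | A. A \<in> \<F> \<and> emeasure \<mu> A \<ge> ennreal (1 - \<beta>)}"

definition min_sets ::
    "'a::topological_space set set \<Rightarrow> ('a set \<Rightarrow> ennreal) \<Rightarrow> 'a measure \<Rightarrow> real \<Rightarrow> 'a set set" where
  "min_sets \<F> \<tau> \<mu> \<alpha> = {A. is_arg_min \<tau> (\<lambda>A. A \<in> \<F> \<and> emeasure \<mu> A \<ge> ennreal (1 - \<alpha>)) A}"

definition regular_measure :: "'a::metric_space set set \<Rightarrow> 'a measure \<Rightarrow> bool" where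
  "regular_measure \<F> \<mu> \<longleftrightarrow>
     (\<forall>B\<in>\<F>. \<forall>\<delta>>0. \<forall>C\<in>\<F>. B \<subseteq> C \<and> emeasure \<mu> B < emeasure \<mu> (nbhd B \<delta> \<inter> C) \<longrightarrow>
        (\<exists>A\<in>\<F>. A \<subseteq> nbhd B \<delta> \<inter> C \<and> emeasure \<mu> B < emeasure \<mu> A))"

text \<open>
  For probability measures \<open>\<mu>s n\<close>, the test function \<open>1\<close> forces the limit \<open>\<mu>\<close> to have total mass
  one, since the Bochner integral of \<open>1\<close> is \<open>0\<close> when the total mass is infinite.
\<close>

definition weakly_converges :: "(nat \<Rightarrow> 'a::topological_space measure) \<Rightarrow> 'a measure \<Rightarrow> bool" where
  "weakly_converges \<mu>s \<mu> \<longleftrightarrow>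
     (\<forall>f :: 'a \<Rightarrow> real. continuous_on UNIV f \<and> bounded (range f) \<longrightarrow>
        (\<lambda>n. \<integral>x. f x \<partial>(\<mu>s n)) \<longlonglongrightarrow> (\<integral>x. f x \<partial>\<mu>))"

definition size_tight ::
    "'w measure \<Rightarrow> 'a::metric_space set set \<Rightarrow> ('a set \<Rightarrow> ennreal) \<Rightarrow>
     (nat \<Rightarrow> 'w \<Rightarrow> 'a measure) \<Rightarrow> 'a measure \<Rightarrow> bool" where
  "size_tight P \<F> \<tau> \<mu>s \<mu> \<longleftrightarrow>
     (\<forall>\<delta>>0. \<forall>B\<in>\<F>. \<tau> B < \<infinity> \<longrightarrow>
       (AE \<omega> in P. \<forall>C\<in>\<F>. B \<subseteq> C \<and> emeasure \<mu> B \<le> liminf (\<lambda>n. emeasure (\<mu>s n \<omega>) C) \<longrightarrow>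
          (\<exists>A\<in>\<F>. emeasure \<mu> B \<le> liminf (\<lambda>n. emeasure (\<mu>s n \<omega>) A) \<and>
                 B \<subseteq> A \<and> A \<subseteq> nbhd B \<delta> \<inter> C \<and> \<tau> A < \<infinity>)))"

end

theory Submission
  imports Defs "HOL-Library.Diagonal_Subsequence"
begin

text \<open>
  Applying tightness repeatedly to a set that is nearly optimal for \<open>\<mu>\<close> produces sets of almost
  the same size that are eventually admissible for \<open>\<mu>\<^sub>n\<close>; with continuity of the minimal size this
  bounds the limes superior of the sizes of minimizers by \<open>\<tau>\<^sup>\<alpha>\<close>. If minimizers \<open>A\<^sub>n\<close> stayed away from
  the minimizers of \<open>\<mu>\<close> along a subsequence, second countability would allow one to thin it out so
  that the lower limits of all further subsequences coincide with the upper limit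
  \<open>\<Inter>\<^sub>j closure (\<Union>\<^sub>k\<^sub>\<ge>\<^sub>j A\<^sub>k)\<close>. By stability some such limit lies in the class. Being an upper
  limit, it carries mass at least \<open>1 - \<alpha>\<close>, so lower semicontinuity makes it a minimizer to
  which the sets converge, a contradiction.
\<close>

section \<open>Pointwise form of neighbourhoods and limit sets\<close>

lemma nbhd_iff: "x \<in> nbhd B e \<longleftrightarrow> (\<exists>y\<in>B. dist y x < e)"
  by (auto simp: thickening_def)

lemma set_lim_iff: "x \<in> set_lim B \<longleftrightarrow> (\<forall>e>0. \<forall>\<^sub>F n in sequentially. x \<in> nbhd (B n) e)"
  unfolding set_lim_def eventually_sequentially INT_iff UN_iff
  by (simp only: Ball_def Bex_def greaterThan_iff atLeast_iff UNIV_I simp_thms)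

lemma haus_le: "A \<subseteq> thickening M d B e \<Longrightarrow> e > 0 \<Longrightarrow> haus M d A B \<le> ennreal e"
  unfolding haus_def by (rule Inf_lower) auto

section \<open>Thinning a sequence of sets by a diagonal argument\<close>

text \<open>For a single \<open>U i\<close>, either the sets eventually miss it, or they meet it
  infinitely often and a further subsequence always meets it. Both alternatives survive further
  thinning, so one diagonal subsequence settles all \<open>i\<close>.\<close>

lemma subsequence_meets_or_misses:
  fixes A :: "nat \<Rightarrow> 'a set" and U :: "nat \<Rightarrow> 'a set"
  obtains s :: "nat \<Rightarrow> nat" where "strict_mono s"
    "\<And>i. (\<forall>\<^sub>F k in sequentially. A (s k) \<inter> U i \<noteq> {}) \<or>
         (\<forall>\<^sub>F k in sequentially. A (s k) \<inter> U i = {})"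
proof -
  define Q where "Q i s \<longleftrightarrow> (\<forall>\<^sub>F k in sequentially. A (s k) \<inter> U i \<noteq> {}) \<or>
      (\<forall>\<^sub>F k in sequentially. A (s k) \<inter> U i = {})" for i and s :: "nat \<Rightarrow> nat"
  have ex: "\<exists>r. strict_mono r \<and> Q i (s \<circ> r)" for i and s :: "nat \<Rightarrow> nat"
  proof (cases "\<forall>\<^sub>F k in sequentially. A (s k) \<inter> U i = {}")
    case True
    then show ?thesis
      by (intro exI[of _ id]) (auto simp: Q_def strict_mono_id)
  next
    case False
    then obtain r :: "nat \<Rightarrow> nat" where "strict_mono r" "\<And>k. A (s (r k)) \<inter> U i \<noteq> {}"
      using not_eventually_sequentiallyD[OF False] by auto
    then show ?thesis
      by (intro exI[of _ r]) (simp add: Q_def)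
  qed
  have sub: "Q i (s \<circ> r)" if "strict_mono r" "Q i s" for i and s r :: "nat \<Rightarrow> nat"
    using that(2) eventually_subseq[OF that(1)] unfolding Q_def o_def by auto
  interpret subseqs Q
    by standard (use ex in blast)
  define g where "g = diagseq"
  \<comment> \<open>The diagonal sequence inherits \<open>Q i\<close> only past index
    \<open>i\<close>. As \<open>Q i\<close> depends on eventual behaviour alone, the shift by
    \<open>Suc i\<close> can then be removed.\<close>
  have tail: "Q i (g \<circ> (+) (Suc i))" for i
    unfolding g_def using sub by (rule diagseq_holds)
  have "Q i g" for i
    using tail[of i] eventually_sequentially_seg[of "\<lambda>k. A (g k) \<inter> U i \<noteq> {}" "Suc i"]
      eventually_sequentially_seg[of "\<lambda>k. A (g k) \<inter> U i = {}" "Suc i"]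
    by (simp add: Q_def add.commute)
  moreover have "strict_mono g"
    unfolding g_def by (rule subseq_diagseq)
  ultimately show thesis
    using that[of g] unfolding Q_def by blast
qed

text \<open>The dichotomy is applied to a countable base: a basic set around a point of the upper
  limit is met infinitely often, hence eventually always. The quantifier over \<open>r\<close> is
  essential for later use, because stability of the class supplies an index sequence that cannot be
  chosen and need not be monotone.\<close>

lemma subsequence_upper_limit_le_set_lim:
  fixes A :: "nat \<Rightarrow> 'a::{metric_space,second_countable_topology} set"
  obtains s :: "nat \<Rightarrow> nat" where "strict_mono s"
    "\<And>r :: nat \<Rightarrow> nat. filterlim r at_top sequentially \<Longrightarrow>
       (\<Inter>j. closure (\<Union>k\<in>{j..}. A (s (r k)))) \<subseteq> set_lim (\<lambda>k. A (s (r k)))"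
proof -
  obtain \<B> :: "'a set set" where \<B>: "countable \<B>" "topological_basis \<B>"
    using ex_countable_basis by blast
  have ne: "\<B> \<noteq> {}"
    using \<B>(2) unfolding topological_basis_def by (metis Sup_empty UNIV_not_empty open_UNIV subset_empty)
  define U where "U = from_nat_into \<B>"
  obtain s :: "nat \<Rightarrow> nat" where s: "strict_mono s"
    "\<And>i. (\<forall>\<^sub>F k in sequentially. A (s k) \<inter> U i \<noteq> {}) \<or>
         (\<forall>\<^sub>F k in sequentially. A (s k) \<inter> U i = {})"
    by (rule subsequence_meets_or_misses[of A U]) blast
  have "x \<in> set_lim (\<lambda>k. A (s (r k)))"
    if r: "filterlim r at_top sequentially"
      and x: "x \<in> (\<Inter>j. closure (\<Union>k\<in>{j..}. A (s (r k))))" for r :: "nat \<Rightarrow> nat" and x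
    unfolding set_lim_iff
  proof (intro allI impI)
    fix e :: real assume e: "e > 0"
    obtain V where V: "V \<in> \<B>" "x \<in> V" "V \<subseteq> ball x e"
      using topological_basisE[OF \<B>(2), of "ball x e" x] e by auto
    then obtain i where i: "V = U i"
      using from_nat_into_surj[OF \<B>(1)] unfolding U_def by metis
    have "open V"
      using V(1) \<B>(2) topological_basis_open by blast
    have "\<not> (\<forall>\<^sub>F k in sequentially. A (s (r k)) \<inter> U i = {})"
    proof
      assume "\<forall>\<^sub>F k in sequentially. A (s (r k)) \<inter> U i = {}"
      then obtain j where "\<And>k. k \<ge> j \<Longrightarrow> A (s (r k)) \<inter> V = {}"
        unfolding eventually_sequentially i by blast
      then have "V \<inter> (\<Union>k\<in>{j..}. A (s (r k))) = {}"
        by auto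
      then have "V \<inter> closure (\<Union>k\<in>{j..}. A (s (r k))) = {}"
        using open_Int_closure_eq_empty[OF \<open>open V\<close>] by blast
      with x V(2) show False by blast
    qed
    \<comment> \<open>An eventual miss along \<open>s\<close> would be inherited by any
      \<open>r\<close> tending to infinity. So its failure for the reindexed sets is carried back to
      \<open>s\<close>, where the dichotomy is available.\<close>
    then have "\<not> (\<forall>\<^sub>F k in sequentially. A (s k) \<inter> U i = {})"
      using eventually_compose_filterlim[OF _ r] by blast
    then have "\<forall>\<^sub>F k in sequentially. A (s k) \<inter> U i \<noteq> {}"
      using s(2) by blast
    then have "\<forall>\<^sub>F k in sequentially. A (s (r k)) \<inter> U i \<noteq> {}"
      by (rule eventually_compose_filterlim[OF _ r])
    then show "\<forall>\<^sub>F k in sequentially. x \<in> nbhd (A (s (r k))) e"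
    proof eventually_elim
      case (elim k)
      then obtain y where "y \<in> A (s (r k))" "y \<in> V"
        unfolding i by blast
      then show ?case
        using V(3) unfolding nbhd_iff by (auto simp: dist_commute intro!: bexI[of _ y])
    qed
  qed
  then show thesis
    by (intro that[OF s(1)] subsetI)
qed

section \<open>Weak convergence and closed sets\<close>

lemma weakly_converges_prob_space:
  assumes "weakly_converges \<nu> \<mu>" "\<And>n. prob_space (\<nu> n)"
  shows "prob_space \<mu>"
proof -
  have "(\<lambda>n. \<integral>x. (1::real) \<partial>(\<nu> n)) \<longlonglongrightarrow> (\<integral>x. 1 \<partial>\<mu>)"
    using assms(1)[unfolded weakly_converges_def, rule_format, of "\<lambda>_. 1"] by simp
  moreover have "(\<integral>x. (1::real) \<partial>(\<nu> n)) = 1" for n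
    using prob_space.prob_space[OF assms(2)] by simp
  ultimately have "measure \<mu> (space \<mu>) = 1"
    using LIMSEQ_unique[of "\<lambda>_. 1::real" 1] by simp
  \<comment> \<open>\<open>measure\<close> sends an infinite total mass to 0, so the value 1 also
    shows that the total mass is finite.\<close>
  then show ?thesis
    by (intro prob_spaceI) (metis Sigma_Algebra.measure_def emeasure_eq_ennreal_measure
        enn2real_top ennreal_1 zero_neq_one)
qed

text \<open>This is the closed-set half of the portmanteau theorem. The continuous functions
  \<open>f j\<close> dominate the indicator of \<open>F\<close> and converge to it pointwise; a
  single \<open>j\<close> whose \<mu>-integral is within \<open>e\<close> of the mass of
  \<open>F\<close> is fixed before \<open>n\<close> grows.\<close>

lemma weakly_converges_eventually_le:
  fixes F :: "'a::metric_space set"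
  assumes wc: "weakly_converges \<nu> \<mu>" and pr: "\<And>n. prob_space (\<nu> n)"
    and sets_\<nu>: "\<And>n. sets (\<nu> n) = sets borel" and sets_\<mu>: "sets \<mu> = sets borel"
    and F: "closed F" and e: "e > 0"
  shows "\<forall>\<^sub>F n in sequentially. measure (\<nu> n) F \<le> measure \<mu> F + e"
proof (cases "F = {}")
  \<comment> \<open>The empty set is split off because \<open>infdist x {}\<close> is 0 by
    convention, so every \<open>f j\<close> would be constantly 1.\<close>
  case True
  then show ?thesis using e by simp
next
  case False
  interpret \<mu>: prob_space \<mu>
    using wc pr by (rule weakly_converges_prob_space)
  have meas_F: "F \<in> sets (\<nu> n)" "F \<in> sets \<mu>" for n
    using F sets_\<nu> sets_\<mu> by auto
  define f where "f j x = max 0 (1 - real j * infdist x F)" for j x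
  have cont: "continuous_on UNIV (f j)" for j
    unfolding f_def by (intro continuous_intros)
  have f01: "0 \<le> f j x" "f j x \<le> 1" for j x
    using infdist_nonneg[of x F] unfolding f_def by auto
  have bnd: "bounded (range (f j))" for j
    by (rule boundedI[of _ 1]) (use f01 in auto)
  have bm: "f j \<in> borel_measurable borel" for j
    by (rule borel_measurable_continuous_onI[OF cont])
  have bm_\<nu>: "f j \<in> borel_measurable (\<nu> n)" for j n
    using bm measurable_cong_sets[OF sets_\<nu> refl] by blast
  have bm_\<mu>: "f j \<in> borel_measurable \<mu>" for j
    using bm measurable_cong_sets[OF sets_\<mu> refl] by blast
  have lim: "(\<lambda>j. f j x) \<longlonglongrightarrow> indicat_real F x" for x
  proof (cases "x \<in> F")
    case True
    then show ?thesis by (simp add: f_def)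
  next
    case x: False
    then have pos: "infdist x F > 0"
      using F False in_closed_iff_infdist_zero[of F x] infdist_nonneg[of x F] by force
    then obtain N :: nat where N: "real N * infdist x F > 1"
      using reals_Archimedean3 by blast
    have "\<forall>\<^sub>F j in sequentially. f j x = indicat_real F x"
      unfolding eventually_sequentially
    proof (intro exI allI impI)
      fix j assume "N \<le> j"
      then have "real N * infdist x F \<le> real j * infdist x F"
        using pos by (intro mult_right_mono) auto
      then show "f j x = indicat_real F x"
        using N x by (simp add: f_def)
    qed
    then show ?thesis by (rule tendsto_eventually)
  qed
  have "(\<lambda>j. \<integral>x. f j x \<partial>\<mu>) \<longlonglongrightarrow> (\<integral>x. indicat_real F x \<partial>\<mu>)"
    by (rule integral_dominated_convergence[where w = "\<lambda>_. 1"])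
      (use lim f01 bm_\<mu> meas_F(2) in auto)
  then have "(\<lambda>j. \<integral>x. f j x \<partial>\<mu>) \<longlonglongrightarrow> measure \<mu> F"
    using meas_F(2) by simp
  then have "\<forall>\<^sub>F j in sequentially. (\<integral>x. f j x \<partial>\<mu>) < measure \<mu> F + e"
    using e by (intro order_tendstoD) auto
  then obtain j where j: "(\<integral>x. f j x \<partial>\<mu>) < measure \<mu> F + e"
    by (auto dest: eventually_happens)
  have "(\<lambda>n. \<integral>x. f j x \<partial>(\<nu> n)) \<longlonglongrightarrow> (\<integral>x. f j x \<partial>\<mu>)"
    using wc cont bnd unfolding weakly_converges_def by blast
  then have "\<forall>\<^sub>F n in sequentially. (\<integral>x. f j x \<partial>(\<nu> n)) < measure \<mu> F + e"
    using j by (rule order_tendstoD)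
  then show ?thesis
  proof eventually_elim
    case (elim n)
    interpret \<nu>: prob_space "\<nu> n" by (rule pr)
    have "integrable (\<nu> n) (indicat_real F)"
      using meas_F(1) by (simp add: \<nu>.emeasure_finite less_top[symmetric])
    moreover have "integrable (\<nu> n) (f j)"
      by (rule \<nu>.integrable_const_bound[of _ 1]) (use f01 bm_\<nu> in auto)
    ultimately have "(\<integral>x. indicat_real F x \<partial>(\<nu> n)) \<le> (\<integral>x. f j x \<partial>(\<nu> n))"
      by (rule integral_mono) (use f01 in \<open>auto simp: f_def split: split_indicator\<close>)
    then have "measure (\<nu> n) F \<le> (\<integral>x. f j x \<partial>(\<nu> n))"
      using meas_F(1) by simp
    with elim show ?case by simp
  qed
qed

text \<open>Each closed tail union contains \<open>A n\<close> for all large \<open>n\<close>, so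
  its mass under \<open>\<nu> n\<close> is eventually at least \<open>c\<close>. The closed-set
  bound passes this to \<mu>, and continuity from above passes it to the intersection of the
  tails.\<close>

lemma weakly_converges_upper_limit:
  fixes A :: "nat \<Rightarrow> 'a::metric_space set"
  assumes wc: "weakly_converges \<nu> \<mu>" and pr: "\<And>n. prob_space (\<nu> n)"
    and sets_\<nu>: "\<And>n. sets (\<nu> n) = sets borel" and sets_\<mu>: "sets \<mu> = sets borel"
    and A: "\<And>k. closed (A k)" "\<And>k. c \<le> measure (\<nu> k) (A k)"
  shows "c \<le> measure \<mu> (\<Inter>j. closure (\<Union>k\<in>{j..}. A k))"
proof -
  define F where "F j = closure (\<Union>k\<in>{j..}. A k)" for j
  interpret \<mu>: prob_space \<mu>
    using wc pr by (rule weakly_converges_prob_space)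
  have cl: "closed (F j)" for j
    by (simp add: F_def)
  have le: "c \<le> measure \<mu> (F j)" for j
  proof (rule field_le_epsilon)
    fix e :: real assume e: "e > 0"
    have "\<forall>\<^sub>F n in sequentially. measure (\<nu> n) (F j) \<le> measure \<mu> (F j) + e"
      by (rule weakly_converges_eventually_le[OF wc pr sets_\<nu> sets_\<mu> cl e])
    then obtain n where n: "n \<ge> j" "measure (\<nu> n) (F j) \<le> measure \<mu> (F j) + e"
      unfolding eventually_sequentially by (metis nle_le)
    interpret \<nu>: prob_space "\<nu> n" by (rule pr)
    have "A n \<subseteq> F j"
      using n(1) closure_subset unfolding F_def by fastforce
    then have "measure (\<nu> n) (A n) \<le> measure (\<nu> n) (F j)"
      using cl sets_\<nu> by (intro \<nu>.finite_measure_mono) auto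
    with A(2)[of n] n(2) show "c \<le> measure \<mu> (F j) + e" by linarith
  qed
  have "decseq F"
    unfolding F_def by (intro antimonoI closure_mono UN_mono) auto
  then have "(\<lambda>j. measure \<mu> (F j)) \<longlonglongrightarrow> measure \<mu> (\<Inter>j. F j)"
    using cl sets_\<mu> by (intro \<mu>.finite_Lim_measure_decseq) auto
  then show ?thesis
    unfolding F_def[symmetric] using le by (intro LIMSEQ_le_const) auto
qed

lemma weakly_converges_subseq:
  "weakly_converges \<nu> \<mu> \<Longrightarrow> filterlim r at_top sequentially \<Longrightarrow> weakly_converges (\<lambda>k. \<nu> (r k)) \<mu>"
  unfolding weakly_converges_def using filterlim_compose by blast

section \<open>Admissible competitors from tightness\<close>

text \<open>Tightness with radii shrinking to 0, each time inside the set found before, gives sets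
  decreasing to \<open>B\<close>, so their sizes tend to \<open>\<tau> B\<close>. One of them has
  size below \<open>t\<close>, and the strict bound \<open>c < emeasure \<mu> B\<close> turns its
  liminf bound into an eventual one.\<close>

lemma eventually_approximating_set:
  fixes \<F> :: "'a::metric_space set set"
  assumes closed: "\<And>A. A \<in> \<F> \<Longrightarrow> closed A" and UNIV: "UNIV \<in> \<F>"
    and size: "size_function \<F> \<tau>"
    and B: "B \<in> \<F>" "\<tau> B < t" "c < emeasure \<mu> B"
    and mass: "emeasure \<mu> B \<le> liminf (\<lambda>n. emeasure (\<nu> n) UNIV)"
    and tight: "\<And>k C. C \<in> \<F> \<Longrightarrow> B \<subseteq> C \<Longrightarrow> emeasure \<mu> B \<le> liminf (\<lambda>n. emeasure (\<nu> n) C) \<Longrightarrow>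
       \<exists>A\<in>\<F>. emeasure \<mu> B \<le> liminf (\<lambda>n. emeasure (\<nu> n) A) \<and>
          B \<subseteq> A \<and> A \<subseteq> nbhd B (1 / real (Suc k)) \<inter> C \<and> \<tau> A < \<infinity>"
  shows "\<exists>A\<in>\<F>. \<tau> A < t \<and> (\<forall>\<^sub>F n in sequentially. c < emeasure (\<nu> n) A)"
proof -
  define Q where "Q k A \<longleftrightarrow> A \<in> \<F> \<and> emeasure \<mu> B \<le> liminf (\<lambda>n. emeasure (\<nu> n) A) \<and>
      B \<subseteq> A \<and> A \<subseteq> nbhd B (1 / real (Suc k)) \<and> \<tau> A < \<infinity>" for k A
  have "\<exists>A. \<forall>k. Q k (A k) \<and> A (Suc k) \<subseteq> A k"
  \<comment> \<open>The recursion starts from \<open>C = UNIV\<close> and then takes the previous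
    set as \<open>C\<close>; the invariant \<open>Q\<close> records what tightness asks of
    \<open>C\<close>, together with finite size.\<close>
  proof (rule dependent_nat_choice)
    show "\<exists>A. Q 0 A"
      using tight[OF UNIV subset_UNIV mass, of 0] unfolding Q_def by blast
    show "\<exists>A'. Q (Suc k) A' \<and> A' \<subseteq> A" if "Q k A" for A k
      using tight[of A "Suc k"] that unfolding Q_def by blast
  qed
  then obtain A where A: "\<And>k. Q k (A k)" "\<And>k. A (Suc k) \<subseteq> A k"
    by blast
  have Int: "(\<Inter>k. A k) = B"
  proof
    show "B \<subseteq> (\<Inter>k. A k)"
      using A(1) unfolding Q_def by blast
    show "(\<Inter>k. A k) \<subseteq> B"
    proof
      fix x assume x: "x \<in> (\<Inter>k. A k)"
      have "\<exists>y\<in>B. dist y x < e" if "e > 0" for e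
      proof -
        from \<open>e > 0\<close> obtain k where k: "1 / real (Suc k) < e"
          by (rule nat_approx_posE)
        have "x \<in> nbhd B (1 / real (Suc k))"
          using x A(1)[of k] unfolding Q_def by blast
        then show ?thesis
          unfolding nbhd_iff using k less_trans by blast
      qed
      then show "x \<in> B"
        using closed_approachable[OF closed[OF B(1)]] by blast
    qed
  qed
  have "(\<lambda>k. haus UNIV dist (A k) B) \<longlonglongrightarrow> 0"
  proof (rule tendsto_sandwich[OF _ _ tendsto_const])
    show "\<forall>\<^sub>F k in sequentially. haus UNIV dist (A k) B \<le> ennreal (1 / real (Suc k))"
      using A(1) unfolding Q_def by (intro always_eventually allI haus_le) auto
    show "(\<lambda>k. ennreal (1 / real (Suc k))) \<longlonglongrightarrow> 0"
      using tendsto_ennrealI[OF LIMSEQ_inverse_real_of_nat] by (simp add: inverse_eq_divide)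
  qed auto
  moreover have "range A \<subseteq> \<F>" "decseq A" "\<tau> (A 0) < \<infinity>"
    using A unfolding Q_def decseq_Suc_iff by blast+
  ultimately have "(\<lambda>k. \<tau> (A k)) \<longlonglongrightarrow> \<tau> B"
    using size B(1) Int unfolding size_function_def by metis
  then have "\<forall>\<^sub>F k in sequentially. \<tau> (A k) < t"
    using B(2) by (rule order_tendstoD)
  then obtain k where k: "\<tau> (A k) < t"
    by (auto dest: eventually_happens)
  have "c < liminf (\<lambda>n. emeasure (\<nu> n) (A k))"
    using A(1)[of k] B(3) unfolding Q_def by (meson less_le_trans)
  then have "\<forall>\<^sub>F n in sequentially. c < emeasure (\<nu> n) (A k)"
    by (rule less_LiminfD)
  with k A(1)[of k] show ?thesis
    unfolding Q_def by blast
qed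

section \<open>Minimizers for a single realization of the measures\<close>

text \<open>The argument is free of randomness: \<open>approx\<close> collects what tightness and
  continuity of the minimal size yield for one realization.\<close>

lemma haus_min_sets_tendsto_0:
  fixes \<F> :: "'a::{metric_space,second_countable_topology} set set"
  assumes stable: "stable_class \<F>" and metric: "Metric_space \<F> d"
    and size: "size_function \<F> \<tau>"
    and pr: "\<And>n. prob_space (\<nu> n)"
    and sets_\<nu>: "\<And>n. sets (\<nu> n) = sets borel" and sets_\<mu>: "sets \<mu> = sets borel"
    and wc: "weakly_converges \<nu> \<mu>"
    and fin: "min_size \<F> \<tau> \<mu> \<alpha> < \<infinity>"
    and approx: "\<And>t. min_size \<F> \<tau> \<mu> \<alpha> < t \<Longrightarrow>
      \<exists>A\<in>\<F>. \<tau> A < t \<and> (\<forall>\<^sub>F n in sequentially. ennreal (1 - \<alpha>) < emeasure (\<nu> n) A)"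
    and conv: "\<And>A. range A \<subseteq> \<F> \<Longrightarrow> set_lim A \<in> \<F> \<Longrightarrow> \<tau> (set_lim A) < \<infinity> \<Longrightarrow>
           (\<lambda>n. \<tau> (A n)) \<longlonglongrightarrow> \<tau> (set_lim A) \<Longrightarrow> (\<lambda>n. d (A n) (set_lim A)) \<longlonglongrightarrow> 0"
  shows "(\<lambda>n. haus \<F> d (min_sets \<F> \<tau> (\<nu> n) \<alpha>) (min_sets \<F> \<tau> \<mu> \<alpha>)) \<longlonglongrightarrow> 0"
proof -
  interpret d: Metric_space \<F> d by (rule metric)
  have ev: "\<forall>\<^sub>F n in sequentially.
      min_sets \<F> \<tau> (\<nu> n) \<alpha> \<subseteq> thickening \<F> d (min_sets \<F> \<tau> \<mu> \<alpha>) e" if e: "e > 0" for e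
  proof (rule ccontr)
    assume "\<not> ?thesis"
    then obtain q :: "nat \<Rightarrow> nat" where q: "strict_mono q"
      "\<And>n. \<not> min_sets \<F> \<tau> (\<nu> (q n)) \<alpha> \<subseteq> thickening \<F> d (min_sets \<F> \<tau> \<mu> \<alpha>) e"
      using not_eventually_sequentiallyD by blast
    then have "\<forall>n. \<exists>A. A \<in> min_sets \<F> \<tau> (\<nu> (q n)) \<alpha> \<and> A \<notin> thickening \<F> d (min_sets \<F> \<tau> \<mu> \<alpha>) e"
      by blast
    then obtain A where A: "\<And>n. A n \<in> min_sets \<F> \<tau> (\<nu> (q n)) \<alpha>"
      "\<And>n. A n \<notin> thickening \<F> d (min_sets \<F> \<tau> \<mu> \<alpha>) e"
      by metis
    \<comment> \<open>Thinning precedes the appeal to stability, so that the inclusion holds for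
      whichever \<open>r\<close> stability returns.\<close>
    obtain s :: "nat \<Rightarrow> nat" where s: "strict_mono s"
      "\<And>r :: nat \<Rightarrow> nat. filterlim r at_top sequentially \<Longrightarrow>
       (\<Inter>j. closure (\<Union>k\<in>{j..}. A (s (r k)))) \<subseteq> set_lim (\<lambda>k. A (s (r k)))"
      by (rule subsequence_upper_limit_le_set_lim[of A]) blast
    have A_\<F>: "A n \<in> \<F>" and A_mass: "emeasure (\<nu> (q n)) (A n) \<ge> ennreal (1 - \<alpha>)" for n
      using A(1)[of n] by (auto simp: min_sets_def is_arg_min_def)
    have "range (\<lambda>k. A (s k)) \<subseteq> \<F>"
      using A_\<F> by blast
    then obtain r :: "nat \<Rightarrow> nat" where r: "filterlim r at_top sequentially"
      "set_lim (\<lambda>k. A (s (r k))) \<in> \<F>"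
      using stable[unfolded stable_class_def, THEN conjunct2, THEN conjunct2, rule_format,
          of "\<lambda>k. A (s k)"] by blast
    define D where "D k = A (s (r k))" for k
    define L where "L = set_lim D"
    \<comment> \<open>\<open>p k\<close> is the index of the measure for which \<open>D k\<close> is
      a minimizer.\<close>
    define p where "p k = q (s (r k))" for k
    have p: "filterlim p at_top sequentially"
      unfolding p_def
      by (intro filterlim_compose[OF filterlim_subseq[OF q(1)]]
          filterlim_compose[OF filterlim_subseq[OF s(1)]] r(1))
    have L_\<F>: "L \<in> \<F>"
      using r(2) unfolding L_def D_def .
    have closed: "closed X" if "X \<in> \<F>" for X
      using stable that unfolding stable_class_def by blast
    interpret \<mu>: prob_space \<mu>
      using wc pr by (rule weakly_converges_prob_space)
    \<comment> \<open>The mass bound holds for the upper limit of the \<open>D k\<close> and passes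
      to \<open>L\<close>, which contains it by the choice of \<open>s\<close>.\<close>
    have "1 - \<alpha> \<le> measure \<mu> (\<Inter>j. closure (\<Union>k\<in>{j..}. D k))"
    proof (rule weakly_converges_upper_limit[OF weakly_converges_subseq[OF wc p] pr sets_\<nu> sets_\<mu>])
      fix k
      show "closed (D k)"
        using closed A_\<F> by (simp add: D_def)
      interpret \<nu>: prob_space "\<nu> (p k)" by (rule pr)
      show "1 - \<alpha> \<le> measure (\<nu> (p k)) (D k)"
        using A_mass[of "s (r k)"] by (simp add: D_def p_def[symmetric] \<nu>.emeasure_eq_measure)
    qed
    also have "\<dots> \<le> measure \<mu> L"
      using s(2)[OF r(1)] closed[OF L_\<F>] sets_\<mu> unfolding L_def D_def
      by (intro \<mu>.finite_measure_mono) auto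
    finally have L_mass: "ennreal (1 - \<alpha>) \<le> emeasure \<mu> L"
      by (simp add: \<mu>.emeasure_eq_measure)
    have lower: "min_size \<F> \<tau> \<mu> \<alpha> \<le> \<tau> X" if "X \<in> \<F>" "ennreal (1 - \<alpha>) \<le> emeasure \<mu> X" for X
      using that unfolding min_size_def by (intro Inf_lower) auto
    have L_le: "\<tau> L \<le> liminf (\<lambda>k. \<tau> (D k))"
      unfolding L_def
    proof (rule size[unfolded size_function_def, THEN conjunct2, THEN conjunct2, rule_format])
      show "range D \<subseteq> \<F> \<and> set_lim D \<in> \<F>"
        using A_\<F> L_\<F> by (auto simp: D_def L_def)
    qed
    \<comment> \<open>The competitor from \<open>approx\<close> is eventually admissible for
      \<open>\<nu> (p k)\<close>, so the minimizer \<open>D k\<close> is no larger than it.\<close>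
    have upper: "\<forall>\<^sub>F k in sequentially. \<tau> (D k) < t" if t: "min_size \<F> \<tau> \<mu> \<alpha> < t" for t
    proof -
      obtain X where X: "X \<in> \<F>" "\<tau> X < t"
        "\<forall>\<^sub>F n in sequentially. ennreal (1 - \<alpha>) < emeasure (\<nu> n) X"
        using approx[OF t] by blast
      have "\<forall>\<^sub>F k in sequentially. ennreal (1 - \<alpha>) < emeasure (\<nu> (p k)) X"
        by (rule eventually_compose_filterlim[OF X(3) p])
      then show ?thesis
      proof eventually_elim
        case (elim k)
        then have "\<not> \<tau> X < \<tau> (D k)"
          using A(1)[of "s (r k)"] X(1)
          by (auto simp: min_sets_def is_arg_min_def D_def p_def less_imp_le)
        then show ?case using X(2) by (meson le_less_trans not_less)
      qed
    qed
    \<comment> \<open>Lower semicontinuity and \<open>upper\<close> bound the size of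
      \<open>L\<close> from above; its mass makes it admissible for \<mu>, which gives the reverse
      bound.\<close>
    have L_min: "\<tau> L = min_size \<F> \<tau> \<mu> \<alpha>"
    proof (rule antisym)
      show "\<tau> L \<le> min_size \<F> \<tau> \<mu> \<alpha>"
      proof (rule dense_ge)
        fix t assume "min_size \<F> \<tau> \<mu> \<alpha> < t"
        then have "\<forall>\<^sub>F k in sequentially. \<tau> (D k) \<le> t"
          by (rule eventually_mono[OF upper less_imp_le])
        then have "liminf (\<lambda>k. \<tau> (D k)) \<le> t"
          by (intro order_trans[OF Liminf_le_Limsup Limsup_bounded]) simp_all
        with L_le show "\<tau> L \<le> t" by (rule order_trans)
      qed
    qed (rule lower[OF L_\<F> L_mass])
    have "(\<lambda>k. \<tau> (D k)) \<longlonglongrightarrow> \<tau> L"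
    proof (rule order_tendstoI)
      fix t assume "t < \<tau> L"
      then show "\<forall>\<^sub>F k in sequentially. t < \<tau> (D k)"
        using L_le by (intro less_LiminfD) (rule less_le_trans)
    qed (use upper L_min in simp)
    then have "(\<lambda>k. d (D k) L) \<longlonglongrightarrow> 0"
      unfolding L_def using A_\<F> L_\<F> fin L_min
      by (intro conv) (auto simp: L_def[symmetric], simp add: D_def)
    then have "\<forall>\<^sub>F k in sequentially. d (D k) L < e"
      using e by (rule order_tendstoD)
    then obtain k where k: "d (D k) L < e"
      by (auto dest: eventually_happens)
    \<comment> \<open>\<open>L\<close> itself witnesses that \<open>D k\<close> lies within
      \<open>e\<close> of the minimizers, contrary to the choice of the sequence.\<close>
    have "L \<in> min_sets \<F> \<tau> \<mu> \<alpha>"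
      using L_\<F> L_mass lower L_min by (auto simp: min_sets_def is_arg_min_def not_less)
    then have "D k \<in> thickening \<F> d (min_sets \<F> \<tau> \<mu> \<alpha>) e"
      using k L_\<F> A_\<F> unfolding thickening_def D_def
      by (auto simp: d.commute intro!: bexI[of _ L])
    with A(2) show False by (simp add: D_def)
  qed
  show ?thesis
  proof (rule order_tendstoI)
    \<comment> \<open>As \<open>a\<close> may be infinite and the contrast is bounded only
      non-strictly by a radius, a finite \<open>b\<close> strictly below \<open>a\<close> serves as
      the radius.\<close>
    fix a :: ennreal assume "0 < a"
    then obtain b where b: "0 < b" "b < a"
      using dense by blast
    then have "b < top"
      using less_trans[OF b(2)] top.not_eq_extremum by fastforce
    then have e: "b = ennreal (enn2real b)" "enn2real b > 0"
      using b(1) by (simp_all add: enn2real_positive_iff)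
    show "\<forall>\<^sub>F n in sequentially. haus \<F> d (min_sets \<F> \<tau> (\<nu> n) \<alpha>) (min_sets \<F> \<tau> \<mu> \<alpha>) < a"
      using ev[OF e(2)]
    proof eventually_elim
      case (elim n)
      show ?case
        using haus_le[OF elim e(2)] e(1) b(2) by simp
    qed
  qed simp
qed

section \<open>Passage to the almost sure statement\<close>

theorem theorem22:
  fixes P :: "'w measure"
    and \<F> :: "'a::polish_space set set"
    and d\<F> :: "'a set \<Rightarrow> 'a set \<Rightarrow> real"
    and \<tau> :: "'a set \<Rightarrow> ennreal"
    and \<mu>s :: "nat \<Rightarrow> 'w \<Rightarrow> 'a measure"
    and \<mu> :: "'a measure"
    and \<alpha> :: real
  assumes "prob_space P"
    and "stable_class \<F>"
    and "Metric_space \<F> d\<F>"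
    and "size_function \<F> \<tau>"
    and "\<And>n. \<mu>s n \<in> P \<rightarrow>\<^sub>M prob_algebra borel"
    and "sets \<mu> = sets borel"
    and "AE \<omega> in P. weakly_converges (\<lambda>n. \<mu>s n \<omega>) \<mu>"
    and "size_tight P \<F> \<tau> \<mu>s \<mu>"
    and "regular_measure \<F> \<mu>"
    and "0 < \<alpha>" and "\<alpha> < 1"
    and "\<forall>\<^sub>F \<beta> in nhds \<alpha>. min_size \<F> \<tau> \<mu> \<beta> < \<infinity>"
    and "isCont (min_size \<F> \<tau> \<mu>) \<alpha>"
    and "\<And>A. range A \<subseteq> \<F> \<Longrightarrow> set_lim A \<in> \<F> \<Longrightarrow> \<tau> (set_lim A) < \<infinity> \<Longrightarrow>
           (\<lambda>n. \<tau> (A n)) \<longlonglongrightarrow> \<tau> (set_lim A) \<Longrightarrow> (\<lambda>n. d\<F> (A n) (set_lim A)) \<longlonglongrightarrow> 0"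
  shows "AE \<omega> in P.
           (\<lambda>n. haus \<F> d\<F> (min_sets \<F> \<tau> (\<mu>s n \<omega>) \<alpha>) (min_sets \<F> \<tau> \<mu> \<alpha>)) \<longlonglongrightarrow> 0"
proof -
  let ?m = "min_size \<F> \<tau> \<mu> \<alpha>"
  have fin: "?m < \<infinity>"
    using assms(12) by (rule eventually_nhds_x_imp_x)
  have closed: "\<And>A. A \<in> \<F> \<Longrightarrow> closed A" and UNIV_\<F>: "UNIV \<in> \<F>"
    using assms(2) unfolding stable_class_def by blast+
  \<comment> \<open>Left continuity at \<alpha> is used: for \<beta> slightly below \<alpha> the
    minimal size is still below \<open>t\<close>, while the mass required is
    \<open>1 - \<beta>\<close>, strictly more than \<open>1 - \<alpha>\<close>.\<close>
  have near_optimal: "\<exists>B\<in>\<F>. \<tau> B < t \<and> ennreal (1 - \<alpha>) < emeasure \<mu> B" if t: "?m < t" for t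
  proof -
    have "(min_size \<F> \<tau> \<mu> \<longlongrightarrow> ?m) (at_left \<alpha>)"
      using assms(13) unfolding isCont_def by (rule tendsto_within_subset) simp
    then have "\<forall>\<^sub>F \<beta> in at_left \<alpha>. min_size \<F> \<tau> \<mu> \<beta> < t"
      using t by (rule order_tendstoD)
    moreover have "\<forall>\<^sub>F \<beta> in at_left \<alpha>. \<beta> < \<alpha>"
      by (simp add: eventually_at_filter)
    ultimately have "\<forall>\<^sub>F \<beta> in at_left \<alpha>. min_size \<F> \<tau> \<mu> \<beta> < t \<and> \<beta> < \<alpha>"
      by eventually_elim simp
    then obtain \<beta> where \<beta>: "min_size \<F> \<tau> \<mu> \<beta> < t" "\<beta> < \<alpha>"
      using eventually_happens[of _ "at_left \<alpha>"] by auto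
    then obtain B where B: "B \<in> \<F>" "ennreal (1 - \<beta>) \<le> emeasure \<mu> B" "\<tau> B < t"
      unfolding min_size_def Inf_less_iff by blast
    \<comment> \<open>Strictness in \<open>ennreal\<close> requires \<open>1 - \<beta>\<close> to be
      positive, which follows from \<beta> < \<alpha> < 1.\<close>
    moreover have "ennreal (1 - \<alpha>) < ennreal (1 - \<beta>)"
      using \<beta>(2) assms(11) by (intro ennreal_lessI) auto
    ultimately show ?thesis by (meson less_le_trans)
  qed
  have gt: "?m < ?m + ennreal (1 / real (Suc i))" for i
    using fin ennreal_add_left_cancel_less[of ?m 0] by simp
  \<comment> \<open>The exceptional null set in tightness depends on the set and on the radius. A
    countable family of near-optimal sets is therefore fixed before any realization is
    chosen.\<close>
  obtain B where B: "\<And>i. B i \<in> \<F>" "\<And>i. \<tau> (B i) < ?m + ennreal (1 / real (Suc i))"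
    "\<And>i. ennreal (1 - \<alpha>) < emeasure \<mu> (B i)"
    using near_optimal[OF gt] by metis
  have lim_B: "\<exists>i. \<tau> (B i) < t" if "?m < t" for t
  proof -
    have "(\<lambda>i. ?m + ennreal (1 / real (Suc i))) \<longlonglongrightarrow> ?m + ennreal 0"
      using tendsto_ennrealI[OF LIMSEQ_inverse_real_of_nat]
      by (intro tendsto_add tendsto_const) (simp add: inverse_eq_divide)
    then have "\<forall>\<^sub>F i in sequentially. ?m + ennreal (1 / real (Suc i)) < t"
      using that by (intro order_tendstoD) auto
    then show ?thesis
      using B(2) by (auto dest!: eventually_happens intro: less_trans)
  qed
  \<comment> \<open>Only countably many pairs \<open>(i, k)\<close> occur, so their null sets can be
    united; the quantifier over \<open>C\<close> already lies inside each almost sure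
    statement.\<close>
  have tight: "AE \<omega> in P. \<forall>i k. \<forall>C\<in>\<F>.
      B i \<subseteq> C \<and> emeasure \<mu> (B i) \<le> liminf (\<lambda>n. emeasure (\<mu>s n \<omega>) C) \<longrightarrow>
          (\<exists>A\<in>\<F>. emeasure \<mu> (B i) \<le> liminf (\<lambda>n. emeasure (\<mu>s n \<omega>) A) \<and>
              B i \<subseteq> A \<and> A \<subseteq> nbhd (B i) (1 / real (Suc k)) \<inter> C \<and> \<tau> A < \<infinity>)"
  proof (unfold AE_all_countable, intro allI)
    fix i k
    have "\<tau> (B i) < \<infinity>"
      using B(2)[of i] by (rule less_le_trans) simp
    then show "AE \<omega> in P. \<forall>C\<in>\<F>.
      B i \<subseteq> C \<and> emeasure \<mu> (B i) \<le> liminf (\<lambda>n. emeasure (\<mu>s n \<omega>) C) \<longrightarrow>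
          (\<exists>A\<in>\<F>. emeasure \<mu> (B i) \<le> liminf (\<lambda>n. emeasure (\<mu>s n \<omega>) A) \<and>
              B i \<subseteq> A \<and> A \<subseteq> nbhd (B i) (1 / real (Suc k)) \<inter> C \<and> \<tau> A < \<infinity>)"
      using assms(8) B(1)[of i] unfolding size_tight_def by simp
  qed
  show ?thesis
    using assms(7) tight AE_space
  proof eventually_elim
    case (elim \<omega>)
    have "\<mu>s n \<omega> \<in> space (prob_algebra borel)" for n
      using assms(5) elim(3) by (rule measurable_space)
    then have pr: "prob_space (\<mu>s n \<omega>)" and sets_\<mu>s: "sets (\<mu>s n \<omega>) = sets borel" for n
      by (auto simp: space_prob_algebra)
    interpret \<mu>: prob_space \<mu>
      using elim(1) pr by (rule weakly_converges_prob_space)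
    have "emeasure (\<mu>s n \<omega>) UNIV = 1" for n
      using prob_space.emeasure_space_1[OF pr] sets_eq_imp_space_eq[OF sets_\<mu>s] by (metis space_borel)
    then have mass: "emeasure \<mu> X \<le> liminf (\<lambda>n. emeasure (\<mu>s n \<omega>) UNIV)" for X
      by (simp add: Liminf_const \<mu>.measure_le_1)
    show ?case
    proof (rule haus_min_sets_tendsto_0[OF assms(2-4) pr sets_\<mu>s assms(6) elim(1) fin _ assms(14)])
      \<comment> \<open>The uncountably many thresholds \<open>t\<close> are served by the countable
        family, since some \<open>B i\<close> has size below \<open>t\<close>.\<close>
      fix t assume "?m < t"
      then obtain i where i: "\<tau> (B i) < t"
        using lim_B by blast
      show "\<exists>A\<in>\<F>. \<tau> A < t \<and> (\<forall>\<^sub>F n in sequentially. ennreal (1 - \<alpha>) < emeasure (\<mu>s n \<omega>) A)"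
        by (rule eventually_approximating_set[OF closed UNIV_\<F> assms(4) B(1) i B(3) mass])
          (use elim(2) in blast)+
    qed
  qed
qed

end
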